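(* Let $F:\mathcal P\to\mathbb C$ be any function. Then the $q$-bracket of $F$ is given explicitly, in $\mathbb C[[q]]$, by $$\left<F\right>_q=\sum_{\lambda\in\mathcal P}f(\lambda)q^{|\lambda|},$$ where $$f(\lambda)=\sum_{\delta|\lambda}F(\delta)\,\mu(\lambda/\delta)\qquad(\lambda\in\mathcal P).$$
   Context: $\mathcal P$ is the set of all integer partitions $\lambda=(\lambda_1,\dots,\lambda_r)$, $\lambda_1\ge\cdots\ge\lambda_r\ge1$, including the empty partition $\emptyset$. The size is $|\lambda|=\lambda_1+\cdots+\lambda_r$ and the length is $\ell(\lambda)=r$, with $|\emptyset|=\ell(\emptyset)=0$. A partition $\delta$ divides $\lambda$, written $\delta|\lambda$, if all parts of $\delta$ are also parts of $\lambda$, including multiplicity; $\emptyset$ divides every partition. A sum over $\delta|\lambda$ runs over the distinct partitions $\delta$ dividing $\lambda$ (each counted once). If $\delta|\lambda$, the quotient $\lambda/\delta\in\mathcal P$ is formed by deleting the parts of $\delta$ from $\lambda$ (multiset difference). The partition Möbius function is $\mu(\lambda)=0$ if $\lambda$ has any part repeated, and $\mu(\lambda)=(-1)^{\ell(\lambda)}$ otherwise. For a function $f:\mathcal P\to\mathbb C$ the $q$-bracket is $$\left<f\right>_q:=\frac{\sum_{\lambda\in\mathcal P}f(\lambda)q^{|\lambda|}}{\sum_{\lambda\in\mathcal P}q^{|\lambda|}}\in\mathbb C[[q]].$$ *)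

theory Defs
  imports
    Complex_Main
    "HOL-Library.Multiset"
    "HOL-Computational_Algebra.Formal_Power_Series"
begin

text \<open>
  A partition is represented by the multiset of its parts, which is the same data as the
  weakly decreasing sequence.  For a partition, \<open>sum_mset\<close> is its size, \<open>size\<close> its length
  (number of parts), \<open>{#}\<close> the empty partition, \<open>\<subseteq>#\<close> the divisibility relation, and multiset
  difference the quotient by a divisor.
\<close>

definition int_partitions :: "nat multiset set" where
  "int_partitions = {l. \<forall>p\<in>#l. p \<ge> 1}"

definition partition_divisors :: "nat multiset \<Rightarrow> nat multiset set" where
  "partition_divisors l = {d \<in> int_partitions. d \<subseteq># l}"

definition partition_mu :: "nat multiset \<Rightarrow> int" where
  "partition_mu l = (if \<exists>p. count l p \<ge> 2 then 0 else (- 1) ^ size l)"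

text \<open>
  The formal sum of \<open>f(\<lambda>) q^|\<lambda>|\<close> over all partitions, given by its coefficients; each of
  them is a finite sum by \<open>finite_int_partitions_of\<close> below.
\<close>

definition partition_series :: "(nat multiset \<Rightarrow> complex) \<Rightarrow> complex fps" where
  "partition_series f = Abs_fps (\<lambda>n. \<Sum>l | l \<in> int_partitions \<and> sum_mset l = n. f l)"

definition q_bracket :: "(nat multiset \<Rightarrow> complex) \<Rightarrow> complex fps" where
  "q_bracket f = partition_series f / partition_series (\<lambda>_. 1)"

lemma size_le_sum_mset_int_partition:
  "l \<in> int_partitions \<Longrightarrow> size l \<le> sum_mset l"
  unfolding int_partitions_def by (induction l) auto

lemma finite_int_partitions_of: "finite {l \<in> int_partitions. sum_mset l = n}"
proof (rule finite_subset)
  show "{l \<in> int_partitions. sum_mset l = n} \<subseteq> mset ` {xs. set xs \<subseteq> {..n} \<and> length xs \<le> n}"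
  proof
    fix l assume "l \<in> {l \<in> int_partitions. sum_mset l = n}"
    then have l: "l \<in> int_partitions" "sum_mset l = n" by auto
    obtain xs where xs: "l = mset xs" by (metis ex_mset)
    have len: "length xs \<le> n"
      using size_le_sum_mset_int_partition[OF l(1)] l(2) xs by simp
    have sum: "sum_list xs = n"
      using l(2) xs by (simp add: sum_mset_sum_list)
    have "set xs \<subseteq> {..n}"
    proof
      fix x assume "x \<in> set xs"
      then have "x \<le> sum_list xs" by (intro member_le_sum_list) simp_all
      then show "x \<in> {..n}" by (simp add: sum)
    qed
    with len xs show "l \<in> mset ` {xs. set xs \<subseteq> {..n} \<and> length xs \<le> n}" by blast
  qed
  show "finite (mset ` {xs. set xs \<subseteq> {..n} \<and> length xs \<le> n})"
    by (intro finite_imageI finite_lists_length_le) simp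
qed

lemma partition_series_1_nth_0: "fps_nth (partition_series (\<lambda>_. 1)) 0 = 1"
proof -
  have "l = {#}" if "l \<in> int_partitions" "sum_mset l = 0" for l
    using size_le_sum_mset_int_partition[OF that(1)] that(2) by simp
  moreover have "{#} \<in> int_partitions" by (simp add: int_partitions_def)
  ultimately have "{l. l \<in> int_partitions \<and> sum_mset l = 0} = {{#}}"
    by (intro equalityI subsetI; simp)
  then show ?thesis by (simp add: partition_series_def)
qed

text \<open>The denominator is a unit, so \<open>/\<close> is the genuine quotient of power series.\<close>

lemma q_bracket_mult: "q_bracket f * partition_series (\<lambda>_. 1) = partition_series f"
proof -
  have nz: "fps_nth (partition_series (\<lambda>_. 1)) 0 \<noteq> 0"
    by (simp add: partition_series_1_nth_0)
  then show ?thesis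
    by (simp add: q_bracket_def fps_divide_unit mult.assoc inverse_mult_eq_1)
qed

end

theory Submission
  imports Defs
begin

text \<open>
  Joining the parts of two partitions adds their sizes, so multiplying two partition series amounts to a
  Dirichlet-style convolution of their coefficient functions over divisors
  (\<open>partition_series_mult\<close>).  The function \<open>f\<close> of the theorem is the convolution of \<open>F\<close> with the
  partition Moebius function; hence its series is the series of \<open>F\<close> times that of
  \<open>partition_mu\<close>.  As in the classical case, the values of the Moebius function
  over the divisors of a nonempty partition cancel (\<open>sum_partition_mu_divisors\<close>), so that the
  series of \<open>partition_mu\<close> is the inverse of the partition generating function
  (\<open>partition_series_mu_inverse\<close>).  Multiplying by it is thus the division in the
  \<open>q\<close>-bracket.
\<close>

lemma sum_mset_le_if_subset:
  fixes d l :: "nat multiset"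
  shows "d \<subseteq># l \<Longrightarrow> sum_mset d \<le> sum_mset l"
  by (auto simp: mset_subset_eq_exists_conv)

lemma finite_partition_divisors: "finite (partition_divisors l)"
proof (rule finite_subset)
  show "partition_divisors l \<subseteq> (\<Union>m\<le>sum_mset l. {d \<in> int_partitions. sum_mset d = m})"
    by (auto simp: partition_divisors_def sum_mset_le_if_subset)
  show "finite (\<Union>m\<le>sum_mset l. {d \<in> int_partitions. sum_mset d = m})"
    by (intro finite_UN_I finite_int_partitions_of) simp
qed

text \<open>
  A partition \<open>l\<close> together with a divisor \<open>d\<close> is the same as the pair of partitions \<open>d\<close>, \<open>l - d\<close>,
  whose sizes sum to that of \<open>l\<close>; the Cauchy product runs over the latter pairs, grouped by
  the size of \<open>d\<close>.
\<close>

lemma partition_series_mult: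
  "partition_series g * partition_series h =
     partition_series (\<lambda>l. \<Sum>d \<in> partition_divisors l. g d * h (l - d))"
proof (rule fps_ext)
  fix n
  let ?P = "\<lambda>m. {l. l \<in> int_partitions \<and> sum_mset l = m}"
  have fin: "finite (?P m)" for m by (rule finite_int_partitions_of)
  have "fps_nth (partition_series g * partition_series h) n =
          (\<Sum>i=0..n. \<Sum>a\<in>?P i. \<Sum>b\<in>?P (n - i). g a * h b)"
    by (simp add: fps_mult_nth partition_series_def sum_product)
  also have "\<dots> = (\<Sum>(i, a, b)\<in>(SIGMA i:{0..n}. ?P i \<times> ?P (n - i)). g a * h b)"
    by (simp add: sum.Sigma sum.cartesian_product fin)
  also have "\<dots> = (\<Sum>(l, d)\<in>(SIGMA l:?P n. partition_divisors l). g d * h (l - d))"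
    by (rule sum.reindex_bij_witness[where
          i = "\<lambda>(l, d). (sum_mset d, d, l - d)" and j = "\<lambda>(i, a, b). (a + b, a)"])
       (auto simp: partition_divisors_def int_partitions_def sum_mset_diff
             dest: in_diffD intro: sum_mset_le_if_subset)
  also have "\<dots> = fps_nth (partition_series
                     (\<lambda>l. \<Sum>d \<in> partition_divisors l. g d * h (l - d))) n"
    by (simp add: partition_series_def sum.Sigma fin finite_partition_divisors)
  finally show "fps_nth (partition_series g * partition_series h) n =
    fps_nth (partition_series (\<lambda>l. \<Sum>d \<in> partition_divisors l. g d * h (l - d))) n" .
qed

text \<open>
  Only divisors without repeated parts contribute. These are the subsets of the set of parts,
  and the signed count of the subsets of a nonempty finite set vanishes.
\<close>

lemma sum_partition_mu_divisors:
  assumes "l \<in> int_partitions"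
  shows "(\<Sum>d \<in> partition_divisors l. partition_mu d) = (if l = {#} then 1 else 0)"
proof -
  let ?A = "set_mset l"
  have sub: "mset_set ` Pow ?A \<subseteq> partition_divisors l"
  proof
    fix d assume "d \<in> mset_set ` Pow ?A"
    then obtain S where S: "S \<subseteq> ?A" and d: "d = mset_set S" by auto
    have fS: "finite S" using S by (rule finite_subset) simp
    have "d \<subseteq># l"
      using S fS unfolding d by (auto simp: subseteq_mset_def count_mset_set')
    moreover have "d \<in> int_partitions"
      using S fS assms by (auto simp: d int_partitions_def)
    ultimately show "d \<in> partition_divisors l" by (simp add: partition_divisors_def)
  qed
  have zero: "partition_mu d = 0" if "d \<in> partition_divisors l - mset_set ` Pow ?A" for d
  proof (rule ccontr)
    assume "partition_mu d \<noteq> 0"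
    then have "count d p \<le> 1" for p
      by (auto simp: partition_mu_def not_le Suc_le_eq split: if_splits dest: spec[of _ p])
    then have "count d p = 1" if "p \<in># d" for p
      using that by (metis One_nat_def Suc_le_eq count_greater_zero_iff le_antisym)
    then have "d = mset_set (set_mset d)"
      by (intro multiset_eqI) (auto simp: count_mset_set' not_in_iff)
    moreover have "set_mset d \<subseteq> ?A"
      using that by (auto simp: partition_divisors_def dest: mset_subset_eqD)
    ultimately show False using that by blast
  qed
  have inj: "inj_on mset_set (Pow ?A)"
    by (rule inj_onI) (metis PowD finite_set_mset finite_set_mset_mset_set finite_subset)
  have mu: "partition_mu (mset_set S) = (- 1) ^ card S" for S :: "nat set"
    by (auto simp: partition_mu_def count_mset_set' split: if_splits)
  have "(\<Sum>d \<in> partition_divisors l. partition_mu d) = (\<Sum>d \<in> mset_set ` Pow ?A. partition_mu d)"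
    using sub zero by (intro sum.mono_neutral_right finite_partition_divisors) auto
  also have "\<dots> = (\<Sum>S\<in>Pow ?A. \<Prod>p\<in>S. - 1)"
    by (simp add: sum.reindex[OF inj] mu)
  \<comment> \<open>The signed count is the expansion of a product of factors \<open>1 - 1\<close>, one for each part.\<close>
  also have "\<dots> = (\<Prod>p\<in>?A. - 1 + 1)"
    by (subst prod_add) simp_all
  also have "\<dots> = (if l = {#} then 1 else 0)"
    by (simp add: card_gt_0_iff)
  finally show ?thesis .
qed

lemma partition_series_mu_inverse:
  "partition_series (\<lambda>l. of_int (partition_mu l)) * partition_series (\<lambda>_. 1) = 1"
proof (rule fps_ext)
  fix n
  have "fps_nth (partition_series (\<lambda>l. of_int (partition_mu l)) * partition_series (\<lambda>_. 1)) n =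
          (\<Sum>l | l \<in> int_partitions \<and> sum_mset l = n.
             of_int (\<Sum>d \<in> partition_divisors l. partition_mu d))"
    by (simp add: partition_series_mult) (simp add: partition_series_def)
  also have "\<dots> = (\<Sum>l | l \<in> int_partitions \<and> sum_mset l = n. if {#} = l then 1 else 0)"
    by (intro sum.cong) (auto simp: sum_partition_mu_divisors)
  also have "\<dots> = fps_nth 1 n"
    using finite_int_partitions_of[of n] by (auto simp: int_partitions_def)
  finally show "fps_nth (partition_series (\<lambda>l. of_int (partition_mu l)) *
      partition_series (\<lambda>_. 1)) n = fps_nth 1 n" .
qed

theorem theorem4p9:
  fixes F f :: "nat multiset \<Rightarrow> complex"
  assumes "\<And>l. l \<in> int_partitions \<Longrightarrow>
             f l = (\<Sum>d \<in> partition_divisors l. F d * of_int (partition_mu (l - d)))"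
  shows "q_bracket F = partition_series f"
proof -
  let ?M = "partition_series (\<lambda>l. of_int (partition_mu l))"
  have "partition_series f = partition_series F * ?M"
    unfolding partition_series_mult unfolding partition_series_def
    by (intro arg_cong[of _ _ Abs_fps] ext sum.cong) (auto simp: assms)
  also have "\<dots> = q_bracket F * (?M * partition_series (\<lambda>_. 1))"
    by (simp add: q_bracket_mult[of F, symmetric] mult_ac)
  also have "\<dots> = q_bracket F"
    by (simp add: partition_series_mu_inverse)
  finally show ?thesis by simp
qed

end
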